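(* For every integer $n \geq 1$, there is an injection \[ \Phi : Av_n(3412,4321) \rightarrow Av_n(3412,4231,45321,54312). \]
   Context: A permutation $p = p_1 p_2 \cdots p_n$ of $\{1,\dots,n\}$ (one-line notation) contains a pattern $q = q_1 \cdots q_k$ (a permutation of $\{1,\dots,k\}$ in one-line notation) if there are positions $n_1 < n_2 < \cdots < n_k$ such that, for all $i,j$, $p_{n_i} < p_{n_j}$ if and only if $q_i < q_j$. If $p$ does not contain $q$, then $p$ avoids $q$. For a set $S$ of patterns, $Av_n(S)$ denotes the set of permutations of $\{1,\dots,n\}$ that avoid every pattern in $S$; braces around the listed patterns are omitted. *)

theory Defs
  imports "HOL-Combinatorics.Multiset_Permutations"
begin

text \<open>Permutations and patterns are lists in one-line notation, with entries from 1 on;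
  list positions count from 0. The map \<open>f\<close> gives the positions of an occurrence.\<close>

definition contains_pattern :: "nat list \<Rightarrow> nat list \<Rightarrow> bool" where
  "contains_pattern p q \<longleftrightarrow>
     (\<exists>f :: nat \<Rightarrow> nat. strict_mono_on {..<length q} f \<and> f ` {..<length q} \<subseteq> {..<length p} \<and>
        (\<forall>i<length q. \<forall>j<length q. p ! f i < p ! f j \<longleftrightarrow> q ! i < q ! j))"

definition Av :: "nat \<Rightarrow> nat list set \<Rightarrow> nat list set" where
  "Av n S = {p \<in> permutations_of_set {1..n}. \<forall>q\<in>S. \<not> contains_pattern p q}"

end

(* A 4321-avoiding permutation is increasing on the points that are neither left-to-right maxima nor
   right-to-left minima, so it is determined by the positions and values of its left-to-right
   maxima and right-to-left minima. Given a permutation p avoiding 3412 and 4321, rearrange its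
   remaining points: as long as there is an occurrence d b c a of 4231, exchange b and c. This keeps
   the left-to-right maxima and right-to-left minima, and it stops. The result q avoids 4231, and
   comparing the numbers of points in certain corners of p and q shows that q also avoids 3412,
   45321 and 54312. Hence the map from p to q is injective. *)

theory Submission
  imports Defs "HOL-Library.Dual_Ordered_Lattice"
begin

section \<open>Left-to-right maxima and right-to-left minima\<close>

text \<open>This makes lemmas about linear orders applicable to \<open>reflect f\<close>, whose
  arguments and values lie in dual orders.\<close>

instance dual :: (linorder) linorder
proof
  show "x \<le> y \<or> y \<le> x" for x y :: "'a dual"
    unfolding dual_less_eq_iff by (rule linear)
qed

text \<open>Pairs are collected so that an equation between two such sets fixes both positions and
  values.\<close>

definition lr_maxima :: "'a::linorder set \<Rightarrow> ('a \<Rightarrow> 'b::linorder) \<Rightarrow> ('a \<times> 'b) set" where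
  "lr_maxima I f = {(i, f i) |i. i \<in> I \<and> (\<forall>j\<in>I. j < i \<longrightarrow> f j < f i)}"

definition rl_minima :: "'a::linorder set \<Rightarrow> ('a \<Rightarrow> 'b::linorder) \<Rightarrow> ('a \<times> 'b) set" where
  "rl_minima I f = {(i, f i) |i. i \<in> I \<and> (\<forall>j\<in>I. i < j \<longrightarrow> f i < f j)}"

lemma lr_maxima_iff:
  "(i, v) \<in> lr_maxima I f \<longleftrightarrow> i \<in> I \<and> v = f i \<and> (\<forall>j\<in>I. j < i \<longrightarrow> f j < f i)"
  by (auto simp: lr_maxima_def)

lemma rl_minima_iff:
  "(i, v) \<in> rl_minima I f \<longleftrightarrow> i \<in> I \<and> v = f i \<and> (\<forall>j\<in>I. i < j \<longrightarrow> f i < f j)"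
  by (auto simp: rl_minima_def)

text \<open>The reverse-complement: reversing both orders turns right-to-left minima into left-to-right
  maxima, and 54312 into 45321, while 3412, 4321 and 4231 are invariant.\<close>

definition reflect :: "('a \<Rightarrow> 'b) \<Rightarrow> 'a dual \<Rightarrow> 'b dual" where
  "reflect f x = dual (f (undual x))"

lemma reflect_dual [simp]: "reflect f (dual x) = dual (f x)"
  by (simp add: reflect_def)

lemma rl_minima_eq_iff:
  "rl_minima I f = rl_minima I g \<longleftrightarrow>
     lr_maxima (dual ` I) (reflect f) = lr_maxima (dual ` I) (reflect g)"
proof -
  have mem: "(dual i, dual v) \<in> lr_maxima (dual ` I) (reflect h) \<longleftrightarrow> (i, v) \<in> rl_minima I h" for i v h
    unfolding lr_maxima_iff rl_minima_iff by (simp add: inj_image_mem_iff inj_dual)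
  have "rl_minima I h = {(i, v). (dual i, dual v) \<in> lr_maxima (dual ` I) (reflect h)}" for h
    by (auto simp: mem)
  moreover have "lr_maxima (dual ` I) (reflect h) = {(i, v). (undual i, undual v) \<in> rl_minima I h}" for h
    by (auto simp flip: mem)
  ultimately show ?thesis
    by metis
qed

section \<open>Pattern occurrences in functions between linear orders\<close>

text \<open>With arbitrary linear orders, the same predicate serves both a list, as
  \<open>(!) p\<close> on \<open>{..<length p}\<close>, and a reflected function.\<close>

definition occurs_3412 :: "'a::linorder set \<Rightarrow> ('a \<Rightarrow> 'b::linorder) \<Rightarrow> bool" where
  "occurs_3412 I f \<longleftrightarrow> (\<exists>a\<in>I. \<exists>b\<in>I. \<exists>c\<in>I. \<exists>d\<in>I. a < b \<and> b < c \<and> c < d \<and>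
     f c < f d \<and> f d < f a \<and> f a < f b)"

definition occurs_4321 :: "'a::linorder set \<Rightarrow> ('a \<Rightarrow> 'b::linorder) \<Rightarrow> bool" where
  "occurs_4321 I f \<longleftrightarrow> (\<exists>a\<in>I. \<exists>b\<in>I. \<exists>c\<in>I. \<exists>d\<in>I. a < b \<and> b < c \<and> c < d \<and>
     f d < f c \<and> f c < f b \<and> f b < f a)"

definition occurs_4231 :: "'a::linorder set \<Rightarrow> ('a \<Rightarrow> 'b::linorder) \<Rightarrow> bool" where
  "occurs_4231 I f \<longleftrightarrow> (\<exists>a\<in>I. \<exists>b\<in>I. \<exists>c\<in>I. \<exists>d\<in>I. a < b \<and> b < c \<and> c < d \<and>
     f d < f b \<and> f b < f c \<and> f c < f a)"

definition occurs_45321 :: "'a::linorder set \<Rightarrow> ('a \<Rightarrow> 'b::linorder) \<Rightarrow> bool" where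
  "occurs_45321 I f \<longleftrightarrow> (\<exists>a\<in>I. \<exists>b\<in>I. \<exists>c\<in>I. \<exists>d\<in>I. \<exists>e\<in>I. a < b \<and> b < c \<and> c < d \<and> d < e \<and>
     f e < f d \<and> f d < f c \<and> f c < f a \<and> f a < f b)"

definition occurs_54312 :: "'a::linorder set \<Rightarrow> ('a \<Rightarrow> 'b::linorder) \<Rightarrow> bool" where
  "occurs_54312 I f \<longleftrightarrow> (\<exists>a\<in>I. \<exists>b\<in>I. \<exists>c\<in>I. \<exists>d\<in>I. \<exists>e\<in>I. a < b \<and> b < c \<and> c < d \<and> d < e \<and>
     f d < f e \<and> f e < f c \<and> f c < f b \<and> f b < f a)"

lemma occurs_3412I:
  assumes "a \<in> I" "b \<in> I" "c \<in> I" "d \<in> I" "a < b" "b < c" "c < d"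
    "f c < f d" "f d < f a" "f a < f b"
  shows "occurs_3412 I f"
  unfolding occurs_3412_def
  by (intro bexI[of _ a] bexI[of _ b] bexI[of _ c] bexI[of _ d] conjI assms)

lemma occurs_4321I:
  assumes "a \<in> I" "b \<in> I" "c \<in> I" "d \<in> I" "a < b" "b < c" "c < d"
    "f d < f c" "f c < f b" "f b < f a"
  shows "occurs_4321 I f"
  unfolding occurs_4321_def
  by (intro bexI[of _ a] bexI[of _ b] bexI[of _ c] bexI[of _ d] conjI assms)

lemma occurs_4231I:
  assumes "a \<in> I" "b \<in> I" "c \<in> I" "d \<in> I" "a < b" "b < c" "c < d"
    "f d < f b" "f b < f c" "f c < f a"
  shows "occurs_4231 I f"
  unfolding occurs_4231_def
  by (intro bexI[of _ a] bexI[of _ b] bexI[of _ c] bexI[of _ d] conjI assms)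

lemma occurs_45321I:
  assumes "a \<in> I" "b \<in> I" "c \<in> I" "d \<in> I" "e \<in> I" "a < b" "b < c" "c < d" "d < e"
    "f e < f d" "f d < f c" "f c < f a" "f a < f b"
  shows "occurs_45321 I f"
  unfolding occurs_45321_def
  by (intro bexI[of _ a] bexI[of _ b] bexI[of _ c] bexI[of _ d] bexI[of _ e] conjI assms)

lemma occurs_54312I:
  assumes "a \<in> I" "b \<in> I" "c \<in> I" "d \<in> I" "e \<in> I" "a < b" "b < c" "c < d" "d < e"
    "f d < f e" "f e < f c" "f c < f b" "f b < f a"
  shows "occurs_54312 I f"
  unfolding occurs_54312_def
  by (intro bexI[of _ a] bexI[of _ b] bexI[of _ c] bexI[of _ d] bexI[of _ e] conjI assms)

lemma occurs_3412_reflectD: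
  assumes "occurs_3412 (dual ` I) (reflect f)"
  shows "occurs_3412 I f"
proof -
  have "\<exists>a\<in>I. \<exists>b\<in>I. \<exists>c\<in>I. \<exists>d\<in>I. b < a \<and> c < b \<and> d < c \<and>
      f d < f c \<and> f a < f d \<and> f b < f a"
    using assms by (simp add: occurs_3412_def)
  then show ?thesis
    by (elim bexE conjE) (rule occurs_3412I)
qed

lemma occurs_4321_reflectD:
  assumes "occurs_4321 (dual ` I) (reflect f)"
  shows "occurs_4321 I f"
proof -
  have "\<exists>a\<in>I. \<exists>b\<in>I. \<exists>c\<in>I. \<exists>d\<in>I. b < a \<and> c < b \<and> d < c \<and>
      f c < f d \<and> f b < f c \<and> f a < f b"
    using assms by (simp add: occurs_4321_def)
  then show ?thesis
    by (elim bexE conjE) (rule occurs_4321I)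
qed

lemma occurs_4231_reflectD:
  assumes "occurs_4231 (dual ` I) (reflect f)"
  shows "occurs_4231 I f"
proof -
  have "\<exists>a\<in>I. \<exists>b\<in>I. \<exists>c\<in>I. \<exists>d\<in>I. b < a \<and> c < b \<and> d < c \<and>
      f b < f d \<and> f c < f b \<and> f a < f c"
    using assms by (simp add: occurs_4231_def)
  then show ?thesis
    by (elim bexE conjE) (rule occurs_4231I)
qed

lemma occurs_45321_reflectI:
  assumes "occurs_54312 I f"
  shows "occurs_45321 (dual ` I) (reflect f)"
proof -
  obtain a b c d e where "a \<in> I" "b \<in> I" "c \<in> I" "d \<in> I" "e \<in> I"
      "a < b" "b < c" "c < d" "d < e" "f d < f e" "f e < f c" "f c < f b" "f b < f a"
    using assms unfolding occurs_54312_def by (elim bexE conjE) (rule that)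
  then show ?thesis
    by (intro occurs_45321I[of "dual e" _ "dual d" "dual c" "dual b" "dual a"]) auto
qed

section \<open>Locating left-to-right maxima\<close>

text \<open>The leftmost point at or before \<open>i\<close> with value at least \<open>f i\<close>
  works: all points before it are below \<open>f i\<close>.\<close>

lemma lr_maximum_left_above:
  assumes "finite I" "i \<in> I"
  obtains k where "(k, f k) \<in> lr_maxima I f" "k \<in> I" "k \<le> i" "f i \<le> f k"
proof -
  let ?S = "{k \<in> I. k \<le> i \<and> f i \<le> f k}"
  have "finite ?S" "?S \<noteq> {}"
    using assms by auto
  then have "Min ?S \<in> ?S"
    by (rule Min_in)
  moreover have least: "Min ?S \<le> j" if "j \<in> ?S" for j
    using \<open>finite ?S\<close> that by (rule Min_le)
  moreover from calculation have "f j < f (Min ?S)" if "j \<in> I" "j < Min ?S" for j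
    using that least[of j] by (force simp: not_le[symmetric])
  ultimately show thesis
    by (intro that[of "Min ?S"]) (auto simp: lr_maxima_iff)
qed

text \<open>Take the leftmost point to the right of \<open>i\<close> and above it.\<close>

lemma next_lr_maximum:
  assumes "finite I" "(i, f i) \<in> lr_maxima I f" "j \<in> I" "i < j" "f i < f j"
  obtains k where "(k, f k) \<in> lr_maxima I f" "k \<in> I" "i < k" "k \<le> j" "f i < f k"
    "\<And>m. m \<in> I \<Longrightarrow> m < k \<Longrightarrow> f m \<le> f i"
proof -
  let ?S = "{k \<in> I. i < k \<and> f i < f k}"
  have "finite ?S" "?S \<noteq> {}"
    using assms by auto
  then have k: "Min ?S \<in> ?S"
    by (rule Min_in)
  have least: "Min ?S \<le> j" if "j \<in> ?S" for j
    using \<open>finite ?S\<close> that by (rule Min_le)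
  have below: "f m \<le> f i" if "m \<in> I" "m < Min ?S" for m
    using that least[of m] assms(2) by (cases m i rule: linorder_cases) (force simp: lr_maxima_iff)+
  show thesis
  proof (rule that[of "Min ?S"])
    show "(Min ?S, f (Min ?S)) \<in> lr_maxima I f"
      using k below by (force simp: lr_maxima_iff)
  qed (use k below least[of j] assms in auto)
qed

lemma card_ge_3_obtain:
  fixes S :: "'a::linorder set"
  assumes "3 \<le> card S"
  obtains x y z where "x \<in> S" "y \<in> S" "z \<in> S" "x < y" "y < z"
proof -
  obtain T where "T \<subseteq> S" "card T = 3"
    using obtain_subset_with_card_n[OF assms] by metis
  then obtain x y z where "x \<in> S" "y \<in> S" "z \<in> S" "x \<noteq> y" "y \<noteq> z" "x \<noteq> z"
    by (auto simp: card_3_iff)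
  then show thesis
    using that by (metis linorder_neqE)
qed

lemma card_le_2_cases:
  assumes "finite S" "card S \<le> 2" "x \<in> S" "y \<in> S" "z \<in> S"
  shows "x = y \<or> y = z \<or> x = z"
proof (rule ccontr)
  assume "\<not> ?thesis"
  then have "card {x, y, z} = 3"
    by auto
  moreover have "card {x, y, z} \<le> card S"
    using assms by (intro card_mono) auto
  ultimately show False
    using assms(2) by simp
qed

section \<open>Rearrangements without 4231\<close>

text \<open>For consecutive left-to-right maxima \<open>i < j\<close>, no point lies to the left of \<open>j\<close> and above \<open>i\<close>.
  Hence the number of points to the right of \<open>j\<close> and below \<open>i\<close> only depends on the positions and
  the values of \<open>i\<close> and \<open>j\<close>, so it can be computed in \<open>g\<close> instead of \<open>f\<close>; in \<open>g\<close>, three such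
  points would form, together with \<open>i\<close> and \<open>j\<close>, a 3412 or a 4321.\<close>

lemma card_right_below_le_2:
  fixes f g :: "'a::linorder \<Rightarrow> 'b::linorder"
  assumes fin: "finite I" and inj: "inj_on f I" "inj_on g I" and img: "f ` I = g ` I"
    and lr: "lr_maxima I f = lr_maxima I g"
    and avoid: "\<not> occurs_3412 I g" "\<not> occurs_4321 I g"
    and ij: "(i, f i) \<in> lr_maxima I f" "j \<in> I" "i < j" "f i < f j"
  shows "card {k \<in> I. j < k \<and> f k < f i} \<le> 2"
proof -
  \<comment> \<open>\<open>m\<close> is the left-to-right maximum directly after \<open>i\<close>.
    The bound is proved for \<open>m\<close> and passes on to \<open>j\<close> because
    \<open>m \<le> j\<close>.\<close>
  obtain m where m: "(m, f m) \<in> lr_maxima I f" "m \<in> I" "i < m" "m \<le> j" "f i < f m"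
    and below_f: "\<And>k. k \<in> I \<Longrightarrow> k < m \<Longrightarrow> f k \<le> f i"
    using next_lr_maximum[OF fin ij] by metis
  have i: "i \<in> I" "g i = f i" and gm: "g m = f m"
    using ij(1) m(1) lr by (auto simp: lr_maxima_iff)
  \<comment> \<open>In \<open>g\<close>, such a point lies at or below some left-to-right maximum
    \<open>l\<close> before \<open>m\<close>, and there \<open>f\<close> and \<open>g\<close>
    agree.\<close>
  have below_g: "g k \<le> g i" if k: "k \<in> I" "k < m" for k
  proof -
    obtain l where l: "(l, g l) \<in> lr_maxima I g" "l \<in> I" "l \<le> k" "g k \<le> g l"
      using lr_maximum_left_above[OF fin k(1)] by metis
    then have "g l = f l"
      using lr by (metis lr_maxima_iff)
    then show ?thesis
      using below_f[of l] l k i by force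
  qed
  \<comment> \<open>All points before \<open>m\<close> other than \<open>i\<close> are below
    \<open>i\<close>, and their number does not depend on \<open>h\<close>.\<close>
  have count: "card {k \<in> I. h k < h i} = card ({k \<in> I. k < m} - {i}) + card {k \<in> I. m < k \<and> h k < h i}"
    if "inj_on h I" and le: "\<And>k. k \<in> I \<Longrightarrow> k < m \<Longrightarrow> h k \<le> h i" and "h i < h m" for h :: "'a \<Rightarrow> 'b"
  proof -
    have "k \<in> {k \<in> I. h k < h i} \<longleftrightarrow> k \<in> ({k \<in> I. k < m} - {i}) \<union> {k \<in> I. m < k \<and> h k < h i}" for k
    proof (cases "k \<in> I \<and> k < m")
      case True
      moreover have "h k \<noteq> h i" if "k \<noteq> i"
        using inj_onD[OF \<open>inj_on h I\<close>, of k i] True i(1) that by blast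
      ultimately show ?thesis
        using le[of k] by (auto simp: less_le)
    next
      case False
      then show ?thesis
        using \<open>h i < h m\<close> by (cases "k = m") auto
    qed
    then have "{k \<in> I. h k < h i} = ({k \<in> I. k < m} - {i}) \<union> {k \<in> I. m < k \<and> h k < h i}"
      by (rule set_eqI)
    moreover have "card (({k \<in> I. k < m} - {i}) \<union> {k \<in> I. m < k \<and> h k < h i})
        = card ({k \<in> I. k < m} - {i}) + card {k \<in> I. m < k \<and> h k < h i}"
      by (rule card_Un_disjoint) (use fin in auto)
    ultimately show ?thesis
      by (simp only:)
  qed
  \<comment> \<open>The number of values below \<open>v\<close> depends only on the image, so it is
    the same for \<open>f\<close> and \<open>g\<close>.\<close>
  have "card {k \<in> I. h k < v} = card {y \<in> h ` I. y < v}" if "inj_on h I" for h :: "'a \<Rightarrow> 'b" and v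
  proof -
    have "{y \<in> h ` I. y < v} = h ` {k \<in> I. h k < v}"
      by auto
    moreover have "inj_on h {k \<in> I. h k < v}"
      using that by (rule inj_on_subset) blast
    ultimately show ?thesis
      by (simp only: card_image)
  qed
  then have "card {k \<in> I. f k < f i} = card {k \<in> I. g k < g i}"
    by (simp only: inj img i(2))
  then have eq: "card {k \<in> I. m < k \<and> f k < f i} = card {k \<in> I. m < k \<and> g k < g i}"
    using count[of f] count[of g] inj below_f below_g m(5) gm i(2) by simp
  have "card {k \<in> I. m < k \<and> g k < g i} \<le> 2"
  proof (rule ccontr)
    assume "\<not> ?thesis"
    then have "3 \<le> card {k \<in> I. m < k \<and> g k < g i}"
      by simp
    then obtain x y z where "x \<in> {k \<in> I. m < k \<and> g k < g i}" "y \<in> {k \<in> I. m < k \<and> g k < g i}"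
        "z \<in> {k \<in> I. m < k \<and> g k < g i}" "x < y" "y < z"
      by (rule card_ge_3_obtain)
    then have xyz: "x \<in> I" "y \<in> I" "z \<in> I" "m < x" "x < y" "y < z" "g x < g i" "g y < g i" "g z < g i"
      by simp_all
    have im: "g i < g m"
      using m(5) gm i by simp
    have asc: "\<not> g u < g v" if "u \<in> I" "v \<in> I" "m < u" "u < v" "g v < g i" for u v
      using avoid(1) occurs_3412I[of i I m u v g] that i(1) m(2,3) im by blast
    have "g y \<noteq> g x" "g z \<noteq> g y"
      using inj_onD[OF inj(2), of y x] inj_onD[OF inj(2), of z y] xyz(1-3,5,6) by blast+
    moreover have "\<not> g x < g y" "\<not> g y < g z"
      using asc[of x y] asc[of y z] xyz by simp_all
    ultimately have "g y < g x" "g z < g y"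
      by simp_all
    then have "occurs_4321 I g"
      using occurs_4321I[of m I x y z g] xyz m(2) im by simp
    then show False
      using avoid(2) by simp
  qed
  moreover have "card {k \<in> I. j < k \<and> f k < f i} \<le> card {k \<in> I. m < k \<and> f k < f i}"
    using m(4) fin by (intro card_mono) auto
  ultimately show ?thesis
    using eq by simp
qed

text \<open>A left-to-right maximum \<open>k\<close> above \<open>b\<close> would form a 4231 with
  \<open>a\<close>, \<open>b\<close>, \<open>c\<close>. Hence the first point of a 3412 or a 45321
  can be replaced by a left-to-right maximum.\<close>

lemma lr_maximum_below_second:
  assumes fin: "finite I" and inj: "inj_on f I" and avoid: "\<not> occurs_4231 I f"
    and abc: "a \<in> I" "b \<in> I" "c \<in> I" "a < b" "b < c" "f c < f a" "f a < f b"
  obtains k where "(k, f k) \<in> lr_maxima I f" "k \<in> I" "k \<le> a" "f a \<le> f k" "f k < f b"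
proof -
  obtain k where k: "(k, f k) \<in> lr_maxima I f" "k \<in> I" "k \<le> a" "f a \<le> f k"
    using lr_maximum_left_above[OF fin abc(1)] by metis
  have "f k < f b"
  proof (rule ccontr)
    assume "\<not> f k < f b"
    moreover have "f k \<noteq> f b"
      using inj k abc by (metis inj_onD leD)
    ultimately have "f b < f k"
      by simp
    moreover from this have "k < a"
      using k(3) abc(7) by (auto simp: le_less)
    ultimately show False
      using avoid occurs_4231I[of k I a b c f] k(2) abc by simp
  qed
  then show thesis
    using that k by blast
qed

text \<open>Here \<open>g\<close> is the given permutation and \<open>f\<close> its rearrangement
  without 4231.\<close>

context
  fixes I :: "'a::linorder set" and f g :: "'a \<Rightarrow> 'b::linorder"
  assumes fin: "finite I" and inj: "inj_on f I" "inj_on g I" and img: "f ` I = g ` I"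
    and lr: "lr_maxima I f = lr_maxima I g"
    and avoid: "\<not> occurs_3412 I g" "\<not> occurs_4321 I g" "\<not> occurs_4231 I f"
begin

text \<open>Once the first point is replaced by a left-to-right maximum \<open>k\<close>, the last
  three points lie to the right of \<open>b\<close> and below \<open>k\<close>, contradicting
  \<open>card_right_below_le_2\<close>.\<close>

lemma avoids_45321: "\<not> occurs_45321 I f"
proof
  assume "occurs_45321 I f"
  then obtain a b c d e where occ: "a \<in> I" "b \<in> I" "c \<in> I" "d \<in> I" "e \<in> I"
      "a < b" "b < c" "c < d" "d < e" "f e < f d" "f d < f c" "f c < f a" "f a < f b"
    unfolding occurs_45321_def by (elim bexE conjE) (rule that)
  obtain k where k: "(k, f k) \<in> lr_maxima I f" "k \<in> I" "k \<le> a" "f a \<le> f k" "f k < f b"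
    using lr_maximum_below_second[OF fin inj(1) avoid(3) occ(1-3,6,7,12,13)] .
  let ?S = "{m \<in> I. b < m \<and> f m < f k}"
  have "c \<in> ?S" "d \<in> ?S" "e \<in> ?S"
    using occ k(4) by auto
  moreover have "card ?S \<le> 2"
    using card_right_below_le_2[OF fin inj img lr avoid(1,2) k(1) occ(2)] k occ by simp
  moreover have "finite ?S"
    using fin by simp
  ultimately show False
    using card_le_2_cases[of ?S c d e] occ by auto
qed

text \<open>Replace \<open>a\<close> by a left-to-right maximum \<open>k\<close>, and
  \<open>b\<close> by the next one, \<open>m\<close>. At most two points lie to the right of
  \<open>b\<close> and below \<open>k\<close>, so these are \<open>c\<close> and \<open>d\<close>,
  which are therefore right-to-left minima. Now \<open>g\<close> agrees with \<open>f\<close> on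
  \<open>k\<close>, \<open>m\<close>, \<open>c\<close>, \<open>d\<close> and contains the same
  3412.\<close>

lemma avoids_3412:
  assumes rl: "rl_minima I f = rl_minima I g"
  shows "\<not> occurs_3412 I f"
proof
  assume "occurs_3412 I f"
  then obtain a b c d where occ: "a \<in> I" "b \<in> I" "c \<in> I" "d \<in> I"
      "a < b" "b < c" "c < d" "f c < f d" "f d < f a" "f a < f b"
    unfolding occurs_3412_def by (elim bexE conjE) (rule that)
  obtain k where k: "(k, f k) \<in> lr_maxima I f" "k \<in> I" "k \<le> a" "f a \<le> f k" "f k < f b"
    using lr_maximum_below_second[OF fin inj(1) avoid(3) occ(1-3,5,6) less_trans[OF occ(8,9)] occ(10)] .
  obtain m where m: "(m, f m) \<in> lr_maxima I f" "m \<in> I" "k < m" "m \<le> b" "f k < f m"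
    using next_lr_maximum[OF fin k(1) occ(2) le_less_trans[OF k(3) occ(5)] k(5)] .
  let ?S = "{m \<in> I. b < m \<and> f m < f k}"
  have "c \<in> ?S" "d \<in> ?S"
    using occ k(4) by auto
  moreover have "card ?S \<le> 2"
    using card_right_below_le_2[OF fin inj img lr avoid(1,2) k(1) occ(2)] k occ by simp
  moreover have "finite ?S"
    using fin by simp
  ultimately have S: "x = c \<or> x = d" if "x \<in> ?S" for x
    using card_le_2_cases[of ?S c d x] occ(7) that by auto
  have "f x < f y" if "x \<in> {c, d}" "y \<in> I" "x < y" for x y
  proof (rule ccontr)
    assume *: "\<not> f x < f y"
    then have "y \<in> ?S"
      using that occ k(4) by auto
    then show False
      using S[of y] * that occ(7,8) by auto
  qed
  then have "(c, f c) \<in> rl_minima I f" "(d, f d) \<in> rl_minima I f"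
    using occ by (auto simp: rl_minima_iff)
  then have "g c = f c" "g d = f d" "g k = f k" "g m = f m"
    using k(1) m(1) lr rl by (auto simp: lr_maxima_iff rl_minima_iff)
  moreover have "m < c" "f d < f k"
    using occ k(4) m(4) by auto
  ultimately have "occurs_3412 I g"
    using occurs_3412I[of k I m c d g] k(2) m(2,3,5) occ by simp
  then show False
    using avoid(1) by simp
qed

end

text \<open>This is \<open>avoids_45321\<close> for the reflected functions.\<close>

lemma avoids_54312:
  fixes f g :: "'a::linorder \<Rightarrow> 'b::linorder"
  assumes "finite I" "inj_on f I" "inj_on g I" "f ` I = g ` I"
    and "rl_minima I f = rl_minima I g"
    and "\<not> occurs_3412 I g" "\<not> occurs_4321 I g" "\<not> occurs_4231 I f"
  shows "\<not> occurs_54312 I f"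
proof -
  have "inj_on (reflect h) (dual ` I)" if "inj_on h I" for h :: "'a \<Rightarrow> 'b"
    using that by (simp add: inj_on_def)
  moreover have "reflect h ` dual ` I = dual ` h ` I" for h :: "'a \<Rightarrow> 'b"
    by (simp add: image_image)
  ultimately have "\<not> occurs_45321 (dual ` I) (reflect f)"
    using assms(1-4) assms(5)[unfolded rl_minima_eq_iff]
      contrapos_nn[OF assms(6) occurs_3412_reflectD] contrapos_nn[OF assms(7) occurs_4321_reflectD]
      contrapos_nn[OF assms(8) occurs_4231_reflectD]
    by (intro avoids_45321[where g = "reflect g"]) simp_all
  then show ?thesis
    by (rule contrapos_nn) (rule occurs_45321_reflectI)
qed

section \<open>Determining a 4321-avoiding permutation\<close>

text \<open>Suppose \<open>f i < g i\<close>. The value \<open>f i\<close> occurs in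
  \<open>g\<close> at a later position \<open>j\<close>. Since \<open>f\<close> and \<open>g\<close>
  differ at \<open>i\<close> and at \<open>j\<close>, in \<open>g\<close> the point at
  \<open>i\<close> is no left-to-right maximum and the point at \<open>j\<close> no right-to-left
  minimum. A larger point before \<open>i\<close> and a smaller one after \<open>j\<close> complete
  them to a 4321 in \<open>g\<close>.\<close>

lemma maxima_minima_determine_less:
  fixes f g :: "'a::linorder \<Rightarrow> 'b::linorder"
  assumes inj: "inj_on f I" "inj_on g I" and img: "f ` I = g ` I"
    and lr: "lr_maxima I f = lr_maxima I g" and rl: "rl_minima I f = rl_minima I g"
    and avoid: "\<not> occurs_4321 I g"
    and i: "i \<in> I" "\<And>j. j \<in> I \<Longrightarrow> j < i \<Longrightarrow> f j = g j"
  shows "\<not> f i < g i"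
proof
  assume less: "f i < g i"
  have "f i \<in> g ` I"
    using i(1) by (simp flip: img)
  then obtain j where j: "j \<in> I" "g j = f i"
    by auto
  have neq: "j \<noteq> i"
    using less j(2) by auto
  have "\<not> j < i"
  proof
    assume "j < i"
    then have "f j = f i"
      using i(2) j by simp
    then show False
      using inj_onD[OF inj(1) _ j(1) i(1)] neq by blast
  qed
  then have "i < j"
    using neq by simp
  have "(i, g i) \<notin> lr_maxima I f"
    using less by (auto simp: lr_maxima_iff)
  then obtain a where a: "a \<in> I" "a < i" "\<not> g a < g i"
    using i(1) by (auto simp: lr lr_maxima_iff)
  have "(j, g j) \<notin> rl_minima I f"
    using inj_onD[OF inj(1) _ j(1) i(1)] neq j(2) by (auto simp: rl_minima_iff)
  then obtain b where b: "b \<in> I" "j < b" "\<not> g j < g b"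
    using j(1) by (auto simp: rl rl_minima_iff)
  have "g a \<noteq> g i" "g j \<noteq> g b"
    using a b i(1) j(1) inj_onD[OF inj(2)] by blast+
  then have "g i < g a" "g b < g j"
    using a(3) b(3) by simp_all
  then have "occurs_4321 I g"
    using occurs_4321I[of a I i j b g] a(1,2) b(1,2) i(1) j less \<open>i < j\<close> by simp
  then show False
    using avoid by simp
qed

lemma maxima_minima_determine:
  fixes f g :: "'a::wellorder \<Rightarrow> 'b::linorder"
  assumes "inj_on f I" "inj_on g I" "f ` I = g ` I"
    and "lr_maxima I f = lr_maxima I g" "rl_minima I f = rl_minima I g"
    and "\<not> occurs_4321 I f" "\<not> occurs_4321 I g"
    and "i \<in> I"
  shows "f i = g i"
  using \<open>i \<in> I\<close>
proof (induction i rule: less_induct)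
  case (less i)
  then have "\<not> f i < g i" "\<not> g i < f i"
    using assms maxima_minima_determine_less[of f I g i] maxima_minima_determine_less[of g I f i] by auto
  then show ?case
    by simp
qed

section \<open>Removing 4231\<close>

text \<open>Before and after the exchange, \<open>b\<close> and \<open>c\<close> are to the right of
  \<open>a\<close> and below it, so neither is a left-to-right maximum. Any other point right of
  \<open>a\<close> has to exceed \<open>f a\<close>, hence both exchanged values; the points up to
  \<open>a\<close> have neither \<open>b\<close> nor \<open>c\<close> before them.\<close>

lemma lr_maxima_swap_middle:
  assumes I: "a \<in> I" "b \<in> I" "c \<in> I"
    and abc: "a < b" "b < c" "f b < f c" "f c < f a"
  shows "lr_maxima I (f(b := f c, c := f b)) = lr_maxima I f"
proof -
  let ?g = "f(b := f c, c := f b)"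
  have neq: "a \<noteq> b" "a \<noteq> c" "b \<noteq> c"
    using abc by auto
  have "(i, v) \<in> lr_maxima I ?g \<longleftrightarrow> (i, v) \<in> lr_maxima I f" for i v
  proof (cases "i = b \<or> i = c")
    case True
    then have "a < i" "?g i < ?g a" "f i < f a"
      using abc neq by auto
    then show ?thesis
      using I(1) by (metis lr_maxima_iff less_asym)
  next
    case False
    then have gi: "?g i = f i"
      by simp
    have "(\<forall>j\<in>I. j < i \<longrightarrow> ?g j < f i) \<longleftrightarrow> (\<forall>j\<in>I. j < i \<longrightarrow> f j < f i)"
    proof (cases "a < i")
      case True
      show ?thesis
      proof (intro iffI ballI impI)
        fix j
        assume less: "\<forall>j\<in>I. j < i \<longrightarrow> ?g j < f i" and j: "j \<in> I" "j < i"
        have "f a < f i"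
          using bspec[OF less I(1)] True neq by simp
        then show "f j < f i"
          using bspec[OF less j(1)] j(2) abc by (cases "j = b \<or> j = c") auto
      next
        fix j
        assume less: "\<forall>j\<in>I. j < i \<longrightarrow> f j < f i" and j: "j \<in> I" "j < i"
        have "f a < f i"
          using bspec[OF less I(1)] True by simp
        then show "?g j < f i"
          using bspec[OF less j(1)] j(2) abc by (cases "j = b \<or> j = c") auto
      qed
    next
      case False
      then have "?g j = f j" if "j < i" for j
        using that abc by auto
      then show ?thesis
        by simp
    qed
    then show ?thesis
      by (simp only: lr_maxima_iff gi)
  qed
  then show ?thesis
    by (simp add: set_eq_iff)
qed

lemma rl_minima_swap_middle:
  assumes "b \<in> I" "c \<in> I" "d \<in> I" "b < c" "c < d" "f d < f b" "f b < f c"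
  shows "rl_minima I (f(b := f c, c := f b)) = rl_minima I f"
proof -
  \<comment> \<open>After reflection, \<open>dual d\<close>, \<open>dual c\<close>,
    \<open>dual b\<close> take the roles of \<open>a\<close>, \<open>b\<close>,
    \<open>c\<close>.\<close>
  have "lr_maxima (dual ` I) ((reflect f)(dual c := reflect f (dual b), dual b := reflect f (dual c)))
      = lr_maxima (dual ` I) (reflect f)"
    using assms by (intro lr_maxima_swap_middle[of "dual d"]) auto
  moreover have "(reflect f)(dual c := reflect f (dual b), dual b := reflect f (dual c))
      = reflect (f(b := f c, c := f b))"
    using assms by (auto simp: reflect_def fun_eq_iff dual_eq_iff)
  ultimately show ?thesis
    by (simp add: rl_minima_eq_iff)
qed

lemma lr_maxima_cong: "(\<And>i. i \<in> I \<Longrightarrow> f i = g i) \<Longrightarrow> lr_maxima I f = lr_maxima I g"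
  by (auto simp: lr_maxima_def)

lemma rl_minima_cong: "(\<And>i. i \<in> I \<Longrightarrow> f i = g i) \<Longrightarrow> rl_minima I f = rl_minima I g"
  by (auto simp: rl_minima_def)

text \<open>Instead of iterating exchanges, take \<open>q\<close> with the prescribed maxima and
  minima that minimizes the sum of position times value. Exchanging the middle points of a 4231
  would lower this sum, by the rearrangement inequality.\<close>

lemma exists_avoiding_4231:
  fixes A :: "nat set"
  assumes "p \<in> permutations_of_set A"
  obtains q where "q \<in> permutations_of_set A"
    "lr_maxima {..<card A} ((!) q) = lr_maxima {..<card A} ((!) p)"
    "rl_minima {..<card A} ((!) q) = rl_minima {..<card A} ((!) p)"
    "\<not> occurs_4231 {..<card A} ((!) q)"
proof -
  let ?I = "{..<card A}"
  let ?P = "\<lambda>q. q \<in> permutations_of_set A \<and> lr_maxima ?I ((!) q) = lr_maxima ?I ((!) p) \<and>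
    rl_minima ?I ((!) q) = rl_minima ?I ((!) p)"
  define w where "w h = (\<Sum>i<card A. i * h i)" for h :: "nat \<Rightarrow> nat"
  obtain q where q: "?P q" and least: "\<And>r. ?P r \<Longrightarrow> w ((!) q) \<le> w ((!) r)"
    using ex_has_least_nat[of ?P p "\<lambda>q. w ((!) q)"] assms by blast
  have len: "length q = card A"
    using q length_finite_permutations_of_set by blast
  have "\<not> occurs_4231 ?I ((!) q)"
  proof
    assume "occurs_4231 ?I ((!) q)"
    then obtain a b c d where occ: "a \<in> ?I" "b \<in> ?I" "c \<in> ?I" "d \<in> ?I" "a < b" "b < c" "c < d"
        "q ! d < q ! b" "q ! b < q ! c" "q ! c < q ! a"
      unfolding occurs_4231_def by (elim bexE conjE) (rule that)
    define r where "r = q[b := q ! c, c := q ! b]"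
    let ?h = "((!) q)(b := q ! c, c := q ! b)"
    have r: "r ! i = ?h i" if "i \<in> ?I" for i
      using that len by (simp add: r_def nth_list_update)
    have "r \<in> permutations_of_set A"
      using q occ len by (auto simp: r_def permutations_of_set_def set_swap)
    moreover have "lr_maxima ?I ((!) r) = lr_maxima ?I ((!) q)"
      using lr_maxima_cong[of ?I "(!) r" ?h] r lr_maxima_swap_middle[of a ?I b c "(!) q"] occ by simp
    moreover have "rl_minima ?I ((!) r) = rl_minima ?I ((!) q)"
      using rl_minima_cong[of ?I "(!) r" ?h] r rl_minima_swap_middle[of b ?I c d "(!) q"] occ by simp
    ultimately have "w ((!) q) \<le> w ((!) r)"
      using least q by simp
    moreover have "w ((!) r) < w ((!) q)"
    proof -
      have split: "w h = b * h b + (c * h c + (\<Sum>i\<in>?I - {b} - {c}. i * h i))" for h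
        unfolding w_def using occ by (simp add: sum.remove[of _ b] sum.remove[of _ c])
      have rest: "(\<Sum>i\<in>?I - {b} - {c}. i * r ! i) = (\<Sum>i\<in>?I - {b} - {c}. i * q ! i)"
        using r by (intro sum.cong) auto
      \<comment> \<open>The two sums differ by \<open>k * l\<close>.\<close>
      obtain k l where "c = b + k" "0 < k" "q ! c = q ! b + l" "0 < l"
        using occ by (metis less_imp_add_positive)
      then have "b * q ! c + c * q ! b < b * q ! b + c * q ! c"
        by (simp add: algebra_simps)
      then show ?thesis
        using split[of "(!) r"] split[of "(!) q"] rest r occ by simp
    qed
    ultimately show False
      by simp
  qed
  then show thesis
    using that q by blast
qed

section \<open>Pattern containment\<close>

lemma contains_patternI:
  assumes "length xs = length q" "sorted_wrt (<) xs" "set xs \<subseteq> {..<length p}"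
    and "\<And>i j. i < length q \<Longrightarrow> j < length q \<Longrightarrow> p ! (xs ! i) < p ! (xs ! j) \<longleftrightarrow> q ! i < q ! j"
  shows "contains_pattern p q"
  unfolding contains_pattern_def
proof (intro exI[of _ "(!) xs"] conjI)
  show "strict_mono_on {..<length q} ((!) xs)"
    using assms(1,2) by (auto simp: strict_mono_on_def sorted_wrt_iff_nth_less)
qed (use assms in force)+

lemma contains_patternE:
  assumes "contains_pattern p q" "length q = n"
  obtains f where "strict_mono_on {..<n} f" "\<forall>i<n. f i < length p"
    "\<forall>i<n. \<forall>j<n. p ! f i < p ! f j \<longleftrightarrow> q ! i < q ! j"
  using assms unfolding contains_pattern_def by (auto simp: image_subset_iff)

lemma contains_3412_iff:
  "contains_pattern p [3,4,1,2] \<longleftrightarrow> occurs_3412 {..<length p} ((!) p)"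
proof
  assume "contains_pattern p [3,4,1,2]"
  then obtain f where f: "strict_mono_on {..<4} f" "\<forall>i<4. f i < length p"
      "\<forall>i<4. \<forall>j<4. p ! f i < p ! f j \<longleftrightarrow> ([3,4,1,2] :: nat list) ! i < [3,4,1,2] ! j"
    by (rule contains_patternE[where n = 4]) (simp, rule that)
  show "occurs_3412 {..<length p} ((!) p)"
    by (intro occurs_3412I[of "f 0" _ "f 1" "f 2" "f 3"]) (use f in \<open>auto simp: strict_mono_on_def\<close>)
next
  assume "occurs_3412 {..<length p} ((!) p)"
  then obtain a b c d where "a < b" "b < c" "c < d" "d \<in> {..<length p}"
      "p ! c < p ! d" "p ! d < p ! a" "p ! a < p ! b"
    unfolding occurs_3412_def by (elim bexE conjE) (rule that)
  then show "contains_pattern p [3,4,1,2]"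
    by (intro contains_patternI[of "[a, b, c, d]"]) (auto simp: less_Suc_eq)
qed

lemma contains_4321_iff:
  "contains_pattern p [4,3,2,1] \<longleftrightarrow> occurs_4321 {..<length p} ((!) p)"
proof
  assume "contains_pattern p [4,3,2,1]"
  then obtain f where f: "strict_mono_on {..<4} f" "\<forall>i<4. f i < length p"
      "\<forall>i<4. \<forall>j<4. p ! f i < p ! f j \<longleftrightarrow> ([4,3,2,1] :: nat list) ! i < [4,3,2,1] ! j"
    by (rule contains_patternE[where n = 4]) (simp, rule that)
  show "occurs_4321 {..<length p} ((!) p)"
    by (intro occurs_4321I[of "f 0" _ "f 1" "f 2" "f 3"]) (use f in \<open>auto simp: strict_mono_on_def\<close>)
next
  assume "occurs_4321 {..<length p} ((!) p)"
  then obtain a b c d where "a < b" "b < c" "c < d" "d \<in> {..<length p}"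
      "p ! d < p ! c" "p ! c < p ! b" "p ! b < p ! a"
    unfolding occurs_4321_def by (elim bexE conjE) (rule that)
  then show "contains_pattern p [4,3,2,1]"
    by (intro contains_patternI[of "[a, b, c, d]"]) (auto simp: less_Suc_eq)
qed

text \<open>4231, 45321 and 54312 are to be avoided by the image only; this direction turns the
  absence of occurrences into avoidance.\<close>

lemma contains_4231_imp:
  assumes "contains_pattern p [4,2,3,1]"
  shows "occurs_4231 {..<length p} ((!) p)"
proof -
  obtain f where f: "strict_mono_on {..<4} f" "\<forall>i<4. f i < length p"
      "\<forall>i<4. \<forall>j<4. p ! f i < p ! f j \<longleftrightarrow> ([4,2,3,1] :: nat list) ! i < [4,2,3,1] ! j"
    using assms by (rule contains_patternE[where n = 4]) (simp, rule that)
  show ?thesis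
    by (intro occurs_4231I[of "f 0" _ "f 1" "f 2" "f 3"]) (use f in \<open>auto simp: strict_mono_on_def\<close>)
qed

lemma contains_45321_imp:
  assumes "contains_pattern p [4,5,3,2,1]"
  shows "occurs_45321 {..<length p} ((!) p)"
proof -
  obtain f where f: "strict_mono_on {..<5} f" "\<forall>i<5. f i < length p"
      "\<forall>i<5. \<forall>j<5. p ! f i < p ! f j \<longleftrightarrow> ([4,5,3,2,1] :: nat list) ! i < [4,5,3,2,1] ! j"
    using assms by (rule contains_patternE[where n = 5]) (simp, rule that)
  show ?thesis
    by (intro occurs_45321I[of "f 0" _ "f 1" "f 2" "f 3" "f 4"]) (use f in \<open>auto simp: strict_mono_on_def\<close>)
qed

lemma contains_54312_imp:
  assumes "contains_pattern p [5,4,3,1,2]"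
  shows "occurs_54312 {..<length p} ((!) p)"
proof -
  obtain f where f: "strict_mono_on {..<5} f" "\<forall>i<5. f i < length p"
      "\<forall>i<5. \<forall>j<5. p ! f i < p ! f j \<longleftrightarrow> ([5,4,3,1,2] :: nat list) ! i < [5,4,3,1,2] ! j"
    using assms by (rule contains_patternE[where n = 5]) (simp, rule that)
  show ?thesis
    by (intro occurs_54312I[of "f 0" _ "f 1" "f 2" "f 3" "f 4"]) (use f in \<open>auto simp: strict_mono_on_def\<close>)
qed

section \<open>The injection\<close>

theorem theorem3p3:
  fixes n :: nat
  assumes "n \<ge> 1"
  shows "\<exists>\<Phi>. \<Phi> ` Av n {[3,4,1,2], [4,3,2,1]}
               \<subseteq> Av n {[3,4,1,2], [4,2,3,1], [4,5,3,2,1], [5,4,3,1,2]}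
           \<and> inj_on \<Phi> (Av n {[3,4,1,2], [4,3,2,1]})"
proof -
  let ?I = "{..<n}"
  let ?A = "Av n {[3,4,1,2], [4,3,2,1]}"
  let ?B = "Av n {[3,4,1,2], [4,2,3,1], [4,5,3,2,1], [5,4,3,1,2]}"
  let ?R = "\<lambda>p q. lr_maxima ?I ((!) q) = lr_maxima ?I ((!) p) \<and>
    rl_minima ?I ((!) q) = rl_minima ?I ((!) p)"
  have perm: "length p = n" "inj_on ((!) p) ?I" "(!) p ` ?I = {1..n}"
    if "p \<in> permutations_of_set {1..n}" for p
  proof -
    show len: "length p = n"
      using length_finite_permutations_of_set[OF that] by simp
    show "inj_on ((!) p) ?I" "(!) p ` ?I = {1..n}"
      using permutations_of_setD[OF that] len
      by (auto simp: inj_on_nth set_conv_nth)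
  qed
  have A: "p \<in> permutations_of_set {1..n}" "\<not> occurs_3412 ?I ((!) p)" "\<not> occurs_4321 ?I ((!) p)"
    if "p \<in> ?A" for p
  proof -
    show p: "p \<in> permutations_of_set {1..n}"
      using that by (simp add: Av_def)
    have "\<not> contains_pattern p [3,4,1,2]" "\<not> contains_pattern p [4,3,2,1]"
      using that by (simp_all add: Av_def)
    then show "\<not> occurs_3412 ?I ((!) p)" "\<not> occurs_4321 ?I ((!) p)"
      by (simp_all only: contains_3412_iff contains_4321_iff perm(1)[OF p] not_False_eq_True)
  qed
  have "\<exists>q\<in>?B. ?R p q" if p: "p \<in> ?A" for p
  proof -
    \<comment> \<open>Evaluating \<open>card {1..n}\<close> turns the index set of
      \<open>exists_avoiding_4231\<close> into \<open>{..<n}\<close>.\<close>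
    obtain q where q: "q \<in> permutations_of_set {1..n}" and R: "?R p q"
      and avoid: "\<not> occurs_4231 ?I ((!) q)"
      by (rule exists_avoiding_4231[OF A(1)[OF p], unfolded card_atLeastAtMost diff_Suc_1])
        (rule that, simp_all)
    \<comment> \<open>Below, \<open>q\<close> takes the role of \<open>f\<close> and
      \<open>p\<close> that of \<open>g\<close>.\<close>
    note pq = perm(2)[OF q] perm(2)[OF A(1)[OF p]]
      perm(3)[OF q, folded perm(3)[OF A(1)[OF p]]]
    have "\<not> occurs_3412 ?I ((!) q)"
      using R avoid by (intro avoids_3412[OF _ pq _ A(2,3)[OF p]]) auto
    moreover have "\<not> occurs_45321 ?I ((!) q)"
      using R avoid by (intro avoids_45321[OF _ pq _ A(2,3)[OF p]]) auto
    moreover have "\<not> occurs_54312 ?I ((!) q)"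
      using R avoid by (intro avoids_54312[OF _ pq _ A(2,3)[OF p]]) auto
    ultimately have "q \<in> ?B"
      using q avoid contains_3412_iff[of q] contains_4231_imp[of q] contains_45321_imp[of q]
        contains_54312_imp[of q] perm(1)[OF q] by (auto simp: Av_def)
    then show ?thesis
      using R by blast
  qed
  \<comment> \<open>Any choice of \<open>q\<close> for each \<open>p\<close> will do, since
    injectivity rests on \<open>?R\<close> alone.\<close>
  then obtain \<Phi> where \<Phi>: "\<And>p. p \<in> ?A \<Longrightarrow> \<Phi> p \<in> ?B \<and> ?R p (\<Phi> p)"
    by metis
  have "inj_on \<Phi> ?A"
  proof (rule inj_onI)
    fix p p'
    assume pp': "p \<in> ?A" "p' \<in> ?A" "\<Phi> p = \<Phi> p'"
    \<comment> \<open>Both \<open>p\<close> and \<open>p'\<close> share their maxima and minima with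
      the common image, hence with each other.\<close>
    then have R: "?R p p'"
      using \<Phi> by metis
    note perms = A(1)[OF pp'(1)] A(1)[OF pp'(2)]
    have "p ! i = p' ! i" if "i \<in> ?I" for i
      using maxima_minima_determine[of "(!) p" ?I "(!) p'" i] perm(2,3)[OF perms(1)]
        perm(2,3)[OF perms(2)] R A(3) pp'(1,2) that by simp
    then show "p = p'"
      using perm(1)[OF perms(1)] perm(1)[OF perms(2)] by (intro nth_equalityI) auto
  qed
  then show ?thesis
    using \<Phi> by blast
qed

end
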